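(* For any set $S$ of positive integers, the minimal $S$-universality criterion set is unique; that is, there is exactly one minimal $S$-universality criterion set.
   Context: A $\mathbb Z$-lattice is a free $\mathbb Z$-module $L$ of finite rank with a positive definite symmetric bilinear form $B:L\times L\to\mathbb Z$ (integral valued); $Q(x)=B(x,x)$. A positive integer $a$ (identified with the unary form $ax^2$) is represented by $L$ if $a=Q(x)$ for some $x\in L$. For a set $S$ of positive integers, a $\mathbb Z$-lattice (of any rank) is $S$-universal if it represents every element of $S$. A subset $S_0\subseteq S$ is an $S$-universality criterion set if every $S_0$-universal $\mathbb Z$-lattice is $S$-universal. It is minimal if no proper subset of $S_0$ is an $S$-universality criterion set. *)

theory Defs
  imports Complex_Main "HOL-Library.Poly_Mapping"
begin

text \<open>
  The lattice \<open>L\<close> is a submodule of an ambient \<open>\<int>\<close>-module given by \<open>scale\<close>; only the values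
  of \<open>B\<close> on \<open>L \<times> L\<close> matter. Rank 0 is allowed.
\<close>

locale Z_lattice = module scale
  for scale :: "int \<Rightarrow> 'a::ab_group_add \<Rightarrow> 'a" +
  fixes L :: "'a set" and B :: "'a \<Rightarrow> 'a \<Rightarrow> int"
  assumes free_finite_rank: "\<exists>E. finite E \<and> independent E \<and> span E = L"
    and B_sym: "x \<in> L \<Longrightarrow> y \<in> L \<Longrightarrow> B x y = B y x"
    and B_add: "x \<in> L \<Longrightarrow> y \<in> L \<Longrightarrow> z \<in> L \<Longrightarrow> B (x + y) z = B x z + B y z"
    and B_scale: "x \<in> L \<Longrightarrow> y \<in> L \<Longrightarrow> B (scale c x) y = c * B x y"
    and B_pos: "x \<in> L \<Longrightarrow> x \<noteq> 0 \<Longrightarrow> 0 < B x x"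

definition represents :: "'a set \<Rightarrow> ('a \<Rightarrow> 'a \<Rightarrow> int) \<Rightarrow> int \<Rightarrow> bool"
  where "represents L B a \<longleftrightarrow> (\<exists>x\<in>L. B x x = a)"

definition universal :: "int set \<Rightarrow> 'a set \<Rightarrow> ('a \<Rightarrow> 'a \<Rightarrow> int) \<Rightarrow> bool"
  where "universal S L B \<longleftrightarrow> (\<forall>a\<in>S. represents L B a)"

text \<open>
  HOL cannot quantify over all types inside a definition, so \<open>L\<close> ranges over the lattices inside
  the free \<open>\<int>\<close>-module \<open>nat \<Rightarrow>\<^sub>0 int\<close> of countable rank, with arbitrary form \<open>B\<close>. This loses
  nothing: by \<open>Z_lattice_isometric_copy\<close> below, every lattice over any type is isometric to one
  of these, and \<open>criterion_set_any_type\<close> transfers the criterion to lattices over any type.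
\<close>

definition criterion_set :: "int set \<Rightarrow> int set \<Rightarrow> bool"
  where "criterion_set S S0 \<longleftrightarrow> S0 \<subseteq> S \<and>
    (\<forall>(L :: (nat \<Rightarrow>\<^sub>0 int) set) B. Z_lattice frag_cmul L B \<longrightarrow> universal S0 L B \<longrightarrow> universal S L B)"

definition minimal_criterion_set :: "int set \<Rightarrow> int set \<Rightarrow> bool"
  where "minimal_criterion_set S S0 \<longleftrightarrow>
    criterion_set S S0 \<and> (\<forall>T. T \<subset> S0 \<longrightarrow> \<not> criterion_set S T)"

lemma module_frag_cmul: "module (frag_cmul :: int \<Rightarrow> ('a \<Rightarrow>\<^sub>0 int) \<Rightarrow> _)"
  by unfold_locales (simp_all add: frag_cmul_distrib frag_cmul_distrib2)

lemma Z_lattice_isometric_copy: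
  fixes scale :: "int \<Rightarrow> 'a::ab_group_add \<Rightarrow> 'a"
  assumes "Z_lattice scale L B"
  obtains L' :: "(nat \<Rightarrow>\<^sub>0 int) set" and B' f
  where "Z_lattice frag_cmul L' B'" "module_hom frag_cmul scale f" "bij_betw f L' L"
    "\<And>x y. x \<in> L' \<Longrightarrow> y \<in> L' \<Longrightarrow> B (f x) (f y) = B' x y"
proof -
  interpret Z_lattice scale L B by fact
  obtain E where E: "finite E" "independent E" "span E = L"
    using free_finite_rank by blast
  obtain g where g: "bij_betw g {..<card E} E"
    using ex_bij_betw_nat_finite[OF E(1)] by (auto simp: atLeast0LessThan)
  define f :: "(nat \<Rightarrow>\<^sub>0 int) \<Rightarrow> 'a"
    where "f u = (\<Sum>i<card E. scale (Poly_Mapping.lookup u i) (g i))" for u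
  interpret F: module "frag_cmul :: int \<Rightarrow> (nat \<Rightarrow>\<^sub>0 int) \<Rightarrow> _" by (rule module_frag_cmul)
  interpret f: module_hom frag_cmul scale f
    by unfold_locales
      (simp_all add: f_def lookup_add scale_left_distrib sum.distrib scale_sum_right)
  define K where "K = (\<lambda>i. frag_of i) ` {..<card E}"
  have fg: "f (frag_of i) = g i" if "i < card E" for i
  proof -
    have "f (frag_of i) = (\<Sum>j<card E. if j = i then g i else 0)"
      unfolding f_def by (intro sum.cong) auto
    then show ?thesis using that by simp
  qed
  have fK: "f ` K = E"
    using g fg by (force simp: K_def bij_betw_def image_image)
  have injK: "inj_on f K"
    using g fg by (auto simp: K_def bij_betw_def inj_on_def)
  have inj: "inj_on f (F.span K)"
    using f.inj_on_span_independent_image[of K] fK injK E(2) by simp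
  have img: "f ` F.span K = L"
    using f.span_image[of K] fK E(3) by simp
  have mem: "f x \<in> L" if "x \<in> F.span K" for x
    using that img by blast
  have indep: "F.independent K"
    unfolding F.independent_explicit_module
  proof (intro allI impI)
    fix t u v assume t: "finite t" "t \<subseteq> K" "(\<Sum>v\<in>t. frag_cmul (u v) v) = 0" "v \<in> t"
    have inj_t: "inj_on f t" using injK t(2) by (rule inj_on_subset)
    have "0 = f (\<Sum>v\<in>t. frag_cmul (u v) v)" using t(3) by simp
    also have "\<dots> = (\<Sum>v\<in>t. scale (u v) (f v))" by (simp add: f.sum f.scale)
    also have "\<dots> = (\<Sum>w\<in>f ` t. scale (u (the_inv_into t f w)) w)"
      by (simp add: sum.reindex[OF inj_t] the_inv_into_f_f[OF inj_t])
    finally have "(\<Sum>w\<in>f ` t. scale (u (the_inv_into t f w)) w) = 0" by simp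
    from independentD[OF E(2) _ _ this, of "f v"] t fK
    show "u v = 0" by (auto simp: the_inv_into_f_f[OF inj_t])
  qed
  have "Z_lattice frag_cmul (F.span K) (\<lambda>x y. B (f x) (f y))"
  proof unfold_locales
    show "\<exists>E. finite E \<and> F.independent E \<and> F.span E = F.span K"
      using indep by (intro exI[of _ K]) (simp add: K_def)
  next
    fix x assume x: "x \<in> F.span K" "x \<noteq> 0"
    then have "f x \<noteq> 0"
      using inj F.span_zero[of K] by (metis f.zero inj_onD)
    with x mem show "0 < B (f x) (f x)" by (simp add: B_pos)
  next
    fix x y assume "x \<in> F.span K" "y \<in> F.span K"
    then show "B (f x) (f y) = B (f y) (f x)" by (intro B_sym mem)
  qed (simp_all add: mem f.add f.scale B_add B_scale)
  then show ?thesis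
    using f.module_hom_axioms inj img by (intro that) (auto simp: bij_betw_def)
qed

lemma criterion_set_any_type:
  assumes "criterion_set S S0" "Z_lattice scale L B" "universal S0 L B"
  shows "universal S L B"
proof -
  obtain L' :: "(nat \<Rightarrow>\<^sub>0 int) set" and B' f where
    *: "Z_lattice frag_cmul L' B'" "bij_betw f L' L"
       "\<And>x y. x \<in> L' \<Longrightarrow> y \<in> L' \<Longrightarrow> B (f x) (f y) = B' x y"
    using Z_lattice_isometric_copy[OF assms(2)] by metis
  have "represents L B a \<longleftrightarrow> represents L' B' a" for a
    using *(2,3) by (auto simp: represents_def bij_betw_def)
  with assms *(1) show ?thesis
    by (auto simp: universal_def criterion_set_def)
qed

end

theory Submission
  imports Defs "HOL-Computational_Algebra.Primes" "HOL-Library.Product_Plus"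
begin

text \<open>
  Call \<open>a \<in> S\<close> a truant if some lattice represents all smaller elements of \<open>S\<close> but not \<open>a\<close>.
  Adjoining to such a lattice the forms \<open>(a + 1)(x\<^sup>2 + y\<^sup>2 + z\<^sup>2 + w\<^sup>2)\<close> and \<open>b x\<^sup>2\<close> for
  \<open>a < b \<le> 2 a + 1\<close> adds no representation of \<open>a\<close>, but by Lagrange's four-square theorem it
  represents every integer exceeding \<open>a\<close>. So \<open>a\<close> belongs to every criterion set. Conversely, the
  least element of \<open>S\<close> missed by a lattice is a truant, so the truants form a criterion set, which
  is therefore the least one.
\<close>

section \<open>Sums of four squares\<close>

definition sum4sq :: "int \<Rightarrow> bool" where
  "sum4sq n \<longleftrightarrow> (\<exists>a b c d. n = a\<^sup>2 + b\<^sup>2 + c\<^sup>2 + d\<^sup>2)"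

lemma sum4sqI: "n = a\<^sup>2 + b\<^sup>2 + c\<^sup>2 + d\<^sup>2 \<Longrightarrow> sum4sq n"
  unfolding sum4sq_def by blast

text \<open>This is multiplicativity of the quaternion norm, the right side being the norm of
  \<open>w + x i + y j + z k\<close> times the conjugate of \<open>a + b i + c j + d k\<close>.
  Conjugating makes the last three components cancel when the two quaternions agree, as the descent
  requires.\<close>

lemma euler_four_square:
  fixes a b c d w x y z :: int
  shows "(a\<^sup>2 + b\<^sup>2 + c\<^sup>2 + d\<^sup>2) * (w\<^sup>2 + x\<^sup>2 + y\<^sup>2 + z\<^sup>2) =
    (a * w + b * x + c * y + d * z)\<^sup>2 + (a * x - b * w + c * z - d * y)\<^sup>2 +
    (a * y - b * z - c * w + d * x)\<^sup>2 + (a * z + b * y - c * x - d * w)\<^sup>2"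
  by algebra

lemma sum4sq_mult: "sum4sq m \<Longrightarrow> sum4sq n \<Longrightarrow> sum4sq (m * n)"
  unfolding sum4sq_def using euler_four_square by metis

text \<open>Shifting by \<open>m div 2\<close> before dividing centres the remainders around
  zero.\<close>

lemma balanced_residue:
  fixes m x :: int
  assumes "0 < m"
  obtains y k where "x = y + m * k" "2 * \<bar>y\<bar> \<le> m"
proof
  define q where "q = (x + m div 2) div m"
  define r where "r = (x + m div 2) mod m"
  have r: "0 \<le> r" "r < m" using assms by (simp_all add: r_def)
  have "x + m div 2 = m * q + r" by (simp add: q_def r_def)
  then show "x = (r - m div 2) + m * q" by simp
  show "2 * \<bar>r - m div 2\<bar> \<le> m" using r by presburger
qed

lemma four_mult_square_le:
  fixes y m :: int
  assumes "2 * \<bar>y\<bar> \<le> m"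
  shows "4 * y\<^sup>2 \<le> m\<^sup>2"
  using power_mono[of "2 * \<bar>y\<bar>" m 2] assms by (simp add: power_mult_distrib)

text \<open>The cross term \<open>2 * y * m * k\<close> gains a second factor \<open>m\<close> from
  the hypothesis. This serves the residues \<open>0\<close> and \<open>m / 2\<close> in the extreme
  cases of the descent.\<close>

lemma square_cong_modulus_square:
  fixes y k m :: int
  assumes "m dvd 2 * y"
  shows "m\<^sup>2 dvd (y + m * k)\<^sup>2 - y\<^sup>2"
proof -
  obtain j where "2 * y = m * j" using assms by (elim dvdE)
  moreover have "(y + m * k)\<^sup>2 - y\<^sup>2 = m * k * (2 * y) + m\<^sup>2 * k\<^sup>2"
    by (simp add: power2_eq_square algebra_simps)
  ultimately have "(y + m * k)\<^sup>2 - y\<^sup>2 = m\<^sup>2 * (k * j + k\<^sup>2)"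
    by (simp add: power2_eq_square algebra_simps)
  then show ?thesis by simp
qed

text \<open>Fermat descent on the multiplier: reducing the four roots modulo \<open>m\<close> gives
  squares summing to some \<open>m * r\<close>. Multiplying by \<open>m * p\<close> with Euler's
  identity and cancelling \<open>m\<^sup>2\<close> represents \<open>r * p\<close>, where
  \<open>0 < r < m\<close> unless \<open>m = 1\<close>.\<close>

lemma sum4sq_descent:
  fixes p m :: int
  assumes "prime p" "0 < m" "m < p" "sum4sq (m * p)"
  shows "sum4sq p"
  using assms(2-4)
proof (induction "nat m" arbitrary: m rule: less_induct)
  case less
  note m = less.prems
  show ?case
  proof (cases "m = 1")
    case True
    with m show ?thesis by simp
  next
    case False
    obtain a b c d where mp: "m * p = a\<^sup>2 + b\<^sup>2 + c\<^sup>2 + d\<^sup>2"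
      using m(3) unfolding sum4sq_def by blast
    obtain w k where w: "a = w + m * k" "2 * \<bar>w\<bar> \<le> m" using balanced_residue[OF m(1)] .
    obtain x l where x: "b = x + m * l" "2 * \<bar>x\<bar> \<le> m" using balanced_residue[OF m(1)] .
    obtain y i where y: "c = y + m * i" "2 * \<bar>y\<bar> \<le> m" using balanced_residue[OF m(1)] .
    obtain z j where z: "d = z + m * j" "2 * \<bar>z\<bar> \<le> m" using balanced_residue[OF m(1)] .
    note sq = four_mult_square_le[OF w(2)] four_mult_square_le[OF x(2)]
      four_mult_square_le[OF y(2)] four_mult_square_le[OF z(2)]
    define s where "s = w\<^sup>2 + x\<^sup>2 + y\<^sup>2 + z\<^sup>2"
    \<comment> \<open>Expanding the four squares in \<open>mp\<close> shows that
      \<open>m * p - s\<close> is \<open>m\<close> times the bracket, so this \<open>r\<close> is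
      the quotient of \<open>s\<close> by \<open>m\<close>.\<close>
    define r where "r = p - (2 * w * k + m * k\<^sup>2 + 2 * x * l + m * l\<^sup>2 + 2 * y * i + m * i\<^sup>2 +
      2 * z * j + m * j\<^sup>2)"
    have s: "s = m * r"
      using mp unfolding s_def r_def w(1) x(1) y(1) z(1)
      by (simp add: power2_eq_square algebra_simps)
    have "0 \<le> s" by (simp add: s_def)
    have "s \<le> m * m" using sq unfolding s_def power2_eq_square by linarith
    have r0: "0 \<le> r" using \<open>0 \<le> s\<close> m(1) unfolding s by (simp add: zero_le_mult_iff)
    have rm: "r \<le> m" using \<open>s \<le> m * m\<close> m(1) unfolding s by simp
    \<comment> \<open>In the extreme cases \<open>r = 0\<close> and \<open>r = m\<close> replacing the residues changes the squares only by
      multiples of \<open>m\<^sup>2\<close>, so \<open>m\<^sup>2\<close> would divide \<open>m * p\<close>.\<close>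
    have False if deg: "m dvd 2 * w" "m dvd 2 * x" "m dvd 2 * y" "m dvd 2 * z" "m dvd r"
    proof -
      have "m\<^sup>2 dvd s" using deg(5) m(1) unfolding s power2_eq_square by simp
      then have "m\<^sup>2 dvd (a\<^sup>2 - w\<^sup>2) + (b\<^sup>2 - x\<^sup>2) + (c\<^sup>2 - y\<^sup>2) + (d\<^sup>2 - z\<^sup>2) + s"
        using deg unfolding w(1) x(1) y(1) z(1)
        by (intro dvd_add square_cong_modulus_square)
      also have "\<dots> = m * p" unfolding mp s_def by simp
      finally have "m dvd p" using m(1) by (simp add: power2_eq_square)
      then show False
        using assms(1) m(1,2) False by (metis less_imp_le less_irrefl prime_int_iff)
    qed
    moreover have "2 * w = 0 \<and> 2 * x = 0 \<and> 2 * y = 0 \<and> 2 * z = 0" if "r = 0"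
      using s that by (simp add: s_def add_nonneg_eq_0_iff)
    moreover have "m dvd 2 * w \<and> m dvd 2 * x \<and> m dvd 2 * y \<and> m dvd 2 * z" if "r = m"
    proof -
      \<comment> \<open>Here \<open>s\<close> is \<open>m\<^sup>2\<close>, the maximum that the four
        bounds in \<open>sq\<close> allow, so each bound is an equality.\<close>
      have "(2 * w)\<^sup>2 = m\<^sup>2 \<and> (2 * x)\<^sup>2 = m\<^sup>2 \<and> (2 * y)\<^sup>2 = m\<^sup>2 \<and> (2 * z)\<^sup>2 = m\<^sup>2"
        using s sq unfolding s_def that power_mult_distrib by (auto simp: power2_eq_square)
      then show ?thesis by (metis dvd_refl pow_divides_pow_iff zero_less_numeral)
    qed
    ultimately have "r \<noteq> 0" "r \<noteq> m" by (metis dvd_0_right, metis dvd_refl)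
    with r0 rm have r: "0 < r" "r < m" by auto
    define A where "A = a * w + b * x + c * y + d * z"
    define B where "B = a * x - b * w + c * z - d * y"
    define C where "C = a * y - b * z - c * w + d * x"
    define D where "D = a * z + b * y - c * x - d * w"
    have prod: "(m * p) * (m * r) = A\<^sup>2 + B\<^sup>2 + C\<^sup>2 + D\<^sup>2"
      unfolding mp s[symmetric] s_def A_def B_def C_def D_def by (rule euler_four_square)
    \<comment> \<open>Modulo \<open>m\<close> the residues may replace \<open>a\<close>,
      \<open>b\<close>, \<open>c\<close>, \<open>d\<close>: then \<open>A\<close> becomes
      \<open>s\<close>, a multiple of \<open>m\<close>, and the terms of \<open>B\<close>,
      \<open>C\<close>, \<open>D\<close> cancel in pairs.\<close>
    have "A = m * (r + k * w + l * x + i * y + j * z)"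
      using s unfolding s_def A_def w(1) x(1) y(1) z(1)
      by (simp add: power2_eq_square algebra_simps)
    then have "m dvd A" by simp
    moreover have "B = m * (k * x - l * w + i * z - j * y)"
      unfolding B_def w(1) x(1) y(1) z(1) by (simp add: algebra_simps)
    then have "m dvd B" by simp
    moreover have "C = m * (k * y - l * z - i * w + j * x)"
      unfolding C_def w(1) x(1) y(1) z(1) by (simp add: algebra_simps)
    then have "m dvd C" by simp
    moreover have "D = m * (k * z + l * y - i * x - j * w)"
      unfolding D_def w(1) x(1) y(1) z(1) by (simp add: algebra_simps)
    then have "m dvd D" by simp
    ultimately obtain A' B' C' D' where
      "A = m * A'" "B = m * B'" "C = m * C'" "D = m * D'" by (elim dvdE)
    then have "m\<^sup>2 * (r * p) = m\<^sup>2 * (A'\<^sup>2 + B'\<^sup>2 + C'\<^sup>2 + D'\<^sup>2)"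
      using prod by (simp add: power2_eq_square algebra_simps)
    then have "r * p = A'\<^sup>2 + B'\<^sup>2 + C'\<^sup>2 + D'\<^sup>2" using m(1) by simp
    then have "sum4sq (r * p)" by (rule sum4sqI)
    with r m show ?thesis by (intro less.hyps[of r]) auto
  qed
qed

text \<open>Equal squares force \<open>p\<close> to divide \<open>x - y\<close> or
  \<open>x + y\<close>, and both are at most \<open>2 * h < p\<close> in absolute value.\<close>

lemma inj_on_square_mod_prime:
  fixes p h :: int
  assumes "prime p" "p = 2 * h + 1"
  shows "inj_on (\<lambda>x. x\<^sup>2 mod p) {0..h}"
proof (rule inj_onI)
  fix x y assume xy: "x \<in> {0..h}" "y \<in> {0..h}" "x\<^sup>2 mod p = y\<^sup>2 mod p"
  then have "p dvd (x - y) * (x + y)"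
    by (simp add: mod_eq_dvd_iff power2_eq_square algebra_simps)
  then have "p dvd x - y \<or> p dvd x + y"
    using assms(1) by (simp add: prime_dvd_mult_iff)
  then show "x = y"
  proof
    assume "p dvd x - y"
    with xy(1,2) assms(2) show ?thesis
      using zdvd_imp_le[of p "x - y"] zdvd_imp_le[of p "y - x"] dvd_diff_commute[of p x y]
      by (cases x y rule: linorder_cases) auto
  next
    assume "p dvd x + y"
    with xy(1,2) assms(2) show ?thesis
      using zdvd_imp_le[of p "x + y"] by (cases "x + y = 0") auto
  qed
qed

text \<open>Pigeonhole: the residues of \<open>x\<^sup>2\<close> and of
  \<open>- 1 - y\<^sup>2\<close> each take \<open>h + 1\<close> values, and \<open>2 * h + 2\<close>
  exceeds the number \<open>p\<close> of residue classes.\<close>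

lemma prime_dvd_sum_two_squares_plus_one:
  fixes p h :: int
  assumes "prime p" "p = 2 * h + 1"
  obtains x y where "x \<in> {0..h}" "y \<in> {0..h}" "p dvd x\<^sup>2 + y\<^sup>2 + 1"
proof -
  define f where "f = (\<lambda>x. x\<^sup>2 mod p)"
  define g where "g = (\<lambda>y. (- 1 - y\<^sup>2) mod p)"
  have p: "0 < p" using assms(1) by (simp add: prime_gt_0_int)
  have f: "inj_on f {0..h}"
    unfolding f_def using assms by (rule inj_on_square_mod_prime)
  have g: "inj_on g {0..h}"
  proof (rule inj_onI)
    fix x y assume "x \<in> {0..h}" "y \<in> {0..h}" "g x = g y"
    moreover from this have "f y = f x"
      by (simp add: f_def g_def mod_eq_dvd_iff)
    ultimately show "x = y" using f by (metis inj_onD)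
  qed
  have "f ` {0..h} \<inter> g ` {0..h} \<noteq> {}"
  proof
    assume "f ` {0..h} \<inter> g ` {0..h} = {}"
    then have "card (f ` {0..h} \<union> g ` {0..h}) = nat (h + 1) + nat (h + 1)"
      by (simp add: card_Un_disjoint card_image f g)
    moreover have "card (f ` {0..h} \<union> g ` {0..h}) \<le> card {0..<p}"
      using p by (intro card_mono) (auto simp: f_def g_def)
    ultimately show False using p assms(2) by auto
  qed
  then obtain x y where "x \<in> {0..h}" "y \<in> {0..h}" "f x = g y" by blast
  moreover from this(3) have "p dvd x\<^sup>2 + y\<^sup>2 + 1"
    by (simp add: f_def g_def mod_eq_dvd_iff algebra_simps)
  ultimately show ?thesis using that by blast
qed

text \<open>The descent starts from \<open>x\<^sup>2 + y\<^sup>2 + 1\<^sup>2 + 0\<^sup>2\<close>, a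
  multiple of \<open>p\<close>. Its multiplier is below \<open>p\<close> because \<open>x\<close>
  and \<open>y\<close> are at most \<open>h\<close>.\<close>

lemma sum4sq_prime:
  fixes p :: int
  assumes "prime p"
  shows "sum4sq p"
proof (cases "p = 2")
  case True
  then show ?thesis by (intro sum4sqI[of _ 1 1 0 0]) simp
next
  case False
  then have "odd p" using assms by (metis primes_dvd_imp_eq two_is_prime_nat prime_int_numeral_eq)
  then obtain h where h: "p = 2 * h + 1" by (elim oddE)
  obtain x y where xy: "x \<in> {0..h}" "y \<in> {0..h}" "p dvd x\<^sup>2 + y\<^sup>2 + 1"
    using assms h by (rule prime_dvd_sum_two_squares_plus_one)
  then obtain m where m: "x\<^sup>2 + y\<^sup>2 + 1 = m * p" by (metis dvdE mult.commute)
  have p: "1 < p" using assms by (simp add: prime_gt_1_int)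
  have "0 < m * p" unfolding m[symmetric] by (simp add: add_nonneg_pos)
  then have "0 < m" using p by (simp add: zero_less_mult_iff)
  have "x\<^sup>2 \<le> h\<^sup>2" "y\<^sup>2 \<le> h\<^sup>2" using xy by (simp_all add: power_mono)
  then have "m * p \<le> 2 * h\<^sup>2 + 1" unfolding m[symmetric] by simp
  also have "\<dots> < p * p"
    using p unfolding h by (simp add: power2_eq_square algebra_simps add_pos_nonneg)
  finally have "m < p" using p by simp
  moreover have "sum4sq (m * p)" using m by (intro sum4sqI[of _ x y 1 0]) simp
  ultimately show ?thesis using assms \<open>0 < m\<close> sum4sq_descent by blast
qed

theorem lagrange_four_squares:
  fixes n :: int
  assumes "0 \<le> n"
  shows "sum4sq n"
  using assms
proof (induction n rule: prime_divisors_induct)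
  case zero
  show ?case by (intro sum4sqI[of _ 0 0 0 0]) simp
next
  case (unit n)
  then show ?case by (intro sum4sqI[of _ 1 0 0 0]) simp
next
  case (factor p n)
  then have "0 \<le> n"
    using prime_gt_0_int[of p] by (simp add: zero_le_mult_iff)
  with factor show ?case by (simp add: sum4sq_mult sum4sq_prime)
qed

section \<open>Adjoining unary forms\<close>

lemma represents_zero:
  assumes "Z_lattice scale L B"
  shows "represents L B 0"
proof -
  interpret Z_lattice scale L B by fact
  have "0 \<in> L" using free_finite_rank span_zero by blast
  with B_scale[of 0 0 0] show ?thesis by (auto simp: represents_def)
qed

lemma represents_nonneg:
  assumes "Z_lattice scale L B" "represents L B n"
  shows "0 \<le> n"
proof -
  interpret Z_lattice scale L B by fact
  obtain x where x: "x \<in> L" "B x x = n" using assms(2) by (auto simp: represents_def)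
  then show ?thesis
    using B_pos[of x] B_scale[of x x 0] by (cases "x = 0") auto
qed

text \<open>A basis of the orthogonal sum consists of a basis of \<open>L\<close> in the first
  coordinate together with \<open>(0, 1)\<close>.\<close>

lemma Z_lattice_orthogonal_unary:
  fixes scale :: "int \<Rightarrow> 'a::ab_group_add \<Rightarrow> 'a"
  assumes "Z_lattice scale L B" and c: "0 < c"
  shows "Z_lattice (\<lambda>k u. (scale k (fst u), k * snd u)) (L \<times> UNIV)
    (\<lambda>u v. B (fst u) (fst v) + c * snd u * snd v)"
proof -
  interpret Z_lattice scale L B by fact
  let ?scale = "\<lambda>k (u :: 'a \<times> int). (scale k (fst u), k * snd u)"
  interpret P: module ?scale
    by unfold_locales (auto simp: scale_right_distrib scale_left_distrib algebra_simps)
  interpret inl: module_hom scale ?scale "\<lambda>x. (x, 0)"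
    by unfold_locales auto
  obtain E where E: "finite E" "independent E" "span E = L"
    using free_finite_rank by blast
  define F where "F = insert (0, 1) ((\<lambda>x. (x, 0 :: int)) ` E)"
  have spanF: "P.span F = L \<times> UNIV"
  proof -
    have "P.span ((\<lambda>x. (x, 0)) ` E) = L \<times> {0}"
      unfolding inl.span_image E(3) by auto
    then show ?thesis unfolding F_def P.span_insert by auto
  qed
  have indep: "P.independent F"
    unfolding P.independent_explicit_module
  proof (intro allI impI)
    fix t u v assume t: "finite t" "t \<subseteq> F" "(\<Sum>v\<in>t. ?scale (u v) v) = 0" "v \<in> t"
    \<comment> \<open>The second coordinate of the relation isolates the coefficient of
      \<open>(0, 1)\<close>; the first coordinate then gives a relation in \<open>E\<close>.\<close>
    have "0 = snd (\<Sum>v\<in>t. ?scale (u v) v)" using t(3) by simp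
    also have "\<dots> = (\<Sum>v\<in>t. u v * snd v)" by (simp add: snd_sum)
    also have "\<dots> = (\<Sum>v\<in>t. if v = (0, 1) then u v else 0)"
      using t(2) by (intro sum.cong) (auto simp: F_def)
    finally have u01: "u (0, 1) = 0" if "(0, 1) \<in> t" using t(1) that by simp
    define t' where "t' = t - {(0, 1)}"
    have t': "finite t'" "t' \<subseteq> (\<lambda>x. (x, 0)) ` E" using t(1,2) by (auto simp: t'_def F_def)
    have inj: "inj_on fst t'" by (rule inj_on_subset[OF _ t'(2)]) (auto simp: inj_on_def)
    have "0 = fst (\<Sum>v\<in>t. ?scale (u v) v)" using t(3) by simp
    also have "\<dots> = (\<Sum>v\<in>t. scale (u v) (fst v))" by (simp add: fst_sum)
    also have "\<dots> = (\<Sum>v\<in>t'. scale (u v) (fst v))"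
      unfolding t'_def using t(1) by (intro sum.mono_neutral_right) auto
    also have "\<dots> = (\<Sum>x\<in>fst ` t'. scale (u (x, 0)) x)"
      unfolding sum.reindex[OF inj] using t'(2) by (intro sum.cong) auto
    finally have "(\<Sum>x\<in>fst ` t'. scale (u (x, 0)) x) = 0" by simp
    from independentD[OF E(2) _ _ this, of "fst v"]
    have "u (fst v, 0) = 0" if "v \<in> t'" using that t' by fastforce
    then show "u v = 0"
      using u01 t(4) t'(2) by (cases "v = (0, 1)") (auto simp: t'_def)
  qed
  have pos: "0 < B (fst w) (fst w) + c * snd w * snd w"
    if "w \<in> L \<times> UNIV" "w \<noteq> 0" for w
  proof (cases "snd w = 0")
    case True
    with that have "fst w \<in> L" "fst w \<noteq> 0" by (auto simp: prod_eq_iff)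
    with True show ?thesis by (simp add: B_pos)
  next
    case False
    have "0 \<le> B (fst w) (fst w)"
      using that(1) by (intro represents_nonneg[OF assms(1)]) (auto simp: represents_def)
    moreover have "0 < c * (snd w)\<^sup>2" using c False by simp
    ultimately show ?thesis
      unfolding power2_eq_square mult.assoc by (rule add_nonneg_pos)
  qed
  show ?thesis
  proof unfold_locales
    show "\<exists>E. finite E \<and> P.independent E \<and> P.span E = L \<times> UNIV"
      using indep spanF E(1) by (intro exI[of _ F]) (simp add: F_def)
  qed (use pos in \<open>auto simp: B_sym B_add B_scale algebra_simps\<close>)
qed

text \<open>The orthogonal sum lives on a product type; copying it back into
  \<open>nat \<Rightarrow>\<^sub>0 int\<close> allows iteration and matches the lattices in
  \<open>criterion_set\<close>.\<close>

lemma adjoin_unary: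
  assumes "Z_lattice scale L B" "0 < c"
  obtains L' :: "(nat \<Rightarrow>\<^sub>0 int) set" and B' where "Z_lattice frag_cmul L' B'"
    "\<And>n. represents L' B' n \<longleftrightarrow> (\<exists>v x. represents L B v \<and> n = v + c * x\<^sup>2)"
proof -
  let ?L = "L \<times> (UNIV :: int set)"
  define C where "C = (\<lambda>u v. B (fst u) (fst v) + c * snd u * snd v)"
  define scale' where "scale' = (\<lambda>k u. (scale k (fst u), k * snd u :: int))"
  have "Z_lattice scale' ?L C"
    unfolding C_def scale'_def using assms by (rule Z_lattice_orthogonal_unary)
  then
  obtain L' :: "(nat \<Rightarrow>\<^sub>0 int) set" and B' f where *: "Z_lattice frag_cmul L' B'"
    "bij_betw f L' ?L" "\<And>x y. x \<in> L' \<Longrightarrow> y \<in> L' \<Longrightarrow> C (f x) (f y) = B' x y"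
    using Z_lattice_isometric_copy by metis
  show ?thesis
  proof
    fix n
    have "represents L' B' n \<longleftrightarrow> (\<exists>w\<in>f ` L'. C w w = n)"
      using *(3) by (auto simp: represents_def)
    also have "f ` L' = ?L" using *(2) by (simp add: bij_betw_def)
    also have "(\<exists>w\<in>?L. C w w = n) \<longleftrightarrow> (\<exists>v x. represents L B v \<and> n = v + c * x\<^sup>2)"
    proof
      assume "\<exists>w\<in>?L. C w w = n"
      then obtain w where "fst w \<in> L" "C w w = n" by auto
      then show "\<exists>v x. represents L B v \<and> n = v + c * x\<^sup>2"
        by (intro exI[of _ "B (fst w) (fst w)"] exI[of _ "snd w"])
          (auto simp: C_def represents_def power2_eq_square)
    next
      assume "\<exists>v x. represents L B v \<and> n = v + c * x\<^sup>2"
      then obtain y x where "y \<in> L" "n = B y y + c * x\<^sup>2" by (auto simp: represents_def)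
      then show "\<exists>w\<in>?L. C w w = n"
        by (intro bexI[of _ "(y, x)"]) (auto simp: C_def power2_eq_square)
    qed
    finally show "represents L' B' n \<longleftrightarrow> (\<exists>v x. represents L B v \<and> n = v + c * x\<^sup>2)" .
  qed fact
qed

text \<open>Since \<open>v\<close> is nonnegative, \<open>v + c * x\<^sup>2\<close> is at least
  \<open>c > a\<close> unless \<open>x = 0\<close>, so \<open>a\<close> could only come from
  \<open>L\<close> itself.\<close>

lemma adjoin_unary_above:
  assumes L: "Z_lattice scale L B" "\<not> represents L B a" and c: "0 \<le> a" "a < c"
  obtains L' :: "(nat \<Rightarrow>\<^sub>0 int) set" and B' where
    "Z_lattice frag_cmul L' B'" "\<not> represents L' B' a"
    "\<And>v x. represents L B v \<Longrightarrow> represents L' B' (v + c * x\<^sup>2)"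
proof -
  obtain L' :: "(nat \<Rightarrow>\<^sub>0 int) set" and B' where L': "Z_lattice frag_cmul L' B'"
    "\<And>n. represents L' B' n \<longleftrightarrow> (\<exists>v x. represents L B v \<and> n = v + c * x\<^sup>2)"
    by (rule adjoin_unary[OF L(1), of c]) (use c in auto)
  have "\<not> represents L' B' a"
  proof
    assume "represents L' B' a"
    then obtain v x where v: "represents L B v" "a = v + c * x\<^sup>2" using L'(2) by blast
    have "0 \<le> v" using L(1) v(1) by (rule represents_nonneg)
    have "x = 0"
    proof (rule ccontr)
      assume "x \<noteq> 0"
      then have "1 \<le> x\<^sup>2" using zero_less_power2[of x] by linarith
      then have "c * 1 \<le> c * x\<^sup>2" using c by (intro mult_left_mono) auto
      with \<open>0 \<le> v\<close> v(2) c(2) show False by simp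
    qed
    with v L(2) show False by simp
  qed
  then show ?thesis using L' by (intro that) blast+
qed

text \<open>The forms are adjoined one at a time; \<open>xs\<close> lists the coordinates along
  them.\<close>

lemma adjoin_unaries_above:
  fixes L :: "(nat \<Rightarrow>\<^sub>0 int) set"
  assumes "Z_lattice frag_cmul L B" "\<not> represents L B a" "0 \<le> a" "\<forall>c\<in>set cs. a < c"
  shows "\<exists>(L' :: (nat \<Rightarrow>\<^sub>0 int) set) B'.
    Z_lattice frag_cmul L' B' \<and> \<not> represents L' B' a \<and>
    (\<forall>v xs. represents L B v \<longrightarrow> length xs = length cs \<longrightarrow>
      represents L' B' (v + (\<Sum>(c, x)\<leftarrow>zip cs xs. c * x\<^sup>2)))"
  using assms
proof (induction cs arbitrary: L B)
  case Nil
  then show ?case by auto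
next
  case (Cons c cs)
  have "a < c" using Cons.prems(4) by simp
  then obtain L1 :: "(nat \<Rightarrow>\<^sub>0 int) set" and B1 where L1:
    "Z_lattice frag_cmul L1 B1" "\<not> represents L1 B1 a"
    "\<And>v x. represents L B v \<Longrightarrow> represents L1 B1 (v + c * x\<^sup>2)"
    using adjoin_unary_above[OF Cons.prems(1-3)] by metis
  obtain L2 :: "(nat \<Rightarrow>\<^sub>0 int) set" and B2 where L2:
    "Z_lattice frag_cmul L2 B2" "\<not> represents L2 B2 a"
    "\<And>v xs. represents L1 B1 v \<Longrightarrow> length xs = length cs \<Longrightarrow>
      represents L2 B2 (v + (\<Sum>(c, x)\<leftarrow>zip cs xs. c * x\<^sup>2))"
    using Cons.IH[OF L1(1,2) Cons.prems(3)] Cons.prems(4) by auto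
  have "represents L2 B2 (v + (\<Sum>(c, x)\<leftarrow>zip (c # cs) xs. c * x\<^sup>2))"
    if "represents L B v" "length xs = length (c # cs)" for v xs
    using that L2(3)[OF L1(3)[OF that(1)]]
    by (cases xs) (auto simp: add.assoc)
  with L2(1,2) show ?case by blast
qed

lemma sum_list_unary_zero_vector:
  fixes cs :: "int list"
  shows "(\<Sum>(c, x)\<leftarrow>zip cs (replicate (length cs) 0). c * x\<^sup>2) = 0"
  by (induction cs) auto

lemma sum_list_unary_unit_vector:
  fixes cs :: "int list"
  assumes "b \<in> set cs"
  obtains xs where "length xs = length cs" "(\<Sum>(c, x)\<leftarrow>zip cs xs. c * x\<^sup>2) = b"
proof -
  obtain us vs where cs: "cs = us @ b # vs" using assms by (meson split_list)
  show ?thesis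
    by (rule that[of "replicate (length us) 0 @ 1 # replicate (length vs) 0"])
      (simp_all add: cs sum_list_unary_zero_vector)
qed

lemma adjoin_all_above:
  fixes L :: "(nat \<Rightarrow>\<^sub>0 int) set"
  assumes L: "Z_lattice frag_cmul L B" "\<not> represents L B a" "0 \<le> a"
  obtains L' :: "(nat \<Rightarrow>\<^sub>0 int) set" and B' where
    "Z_lattice frag_cmul L' B'" "\<not> represents L' B' a"
    "\<And>n. represents L B n \<Longrightarrow> represents L' B' n" "\<And>n. a < n \<Longrightarrow> represents L' B' n"
proof -
  \<comment> \<open>The four copies of \<open>a + 1\<close> in \<open>ds\<close> supply
    \<open>(a + 1) * q\<close> for every \<open>q\<close> \<ge> 0, and a unit vector along
    \<open>cs\<close> supplies any single \<open>b\<close> in its range.\<close>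
  define cs where "cs = [a + 1..2 * a + 1]"
  define ds where "ds = [a + 1, a + 1, a + 1, a + 1]"
  let ?Q = "\<lambda>cs xs. \<Sum>(c, x)\<leftarrow>zip cs xs. c * x\<^sup>2 :: int"
  have "\<forall>c\<in>set (ds @ cs). a < c" by (simp add: ds_def cs_def)
  from adjoin_unaries_above[OF L this]
  obtain L' :: "(nat \<Rightarrow>\<^sub>0 int) set" and B' where L':
    "Z_lattice frag_cmul L' B'" "\<not> represents L' B' a" and
    rep: "\<And>v xs. represents L B v \<Longrightarrow> length xs = length (ds @ cs) \<Longrightarrow>
      represents L' B' (v + ?Q (ds @ cs) xs)"
    by blast
  have rep': "represents L' B' (v + (a + 1) * q + ?Q cs xs)"
    if v: "represents L B v" and q: "0 \<le> q" and xs: "length xs = length cs" for v q xs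
  proof -
    obtain x y z w where "q = x\<^sup>2 + y\<^sup>2 + z\<^sup>2 + w\<^sup>2"
      using lagrange_four_squares[OF q] unfolding sum4sq_def by blast
    then show ?thesis
      using rep[OF v, of "[x, y, z, w] @ xs"] xs by (simp add: ds_def algebra_simps)
  qed
  show ?thesis
  proof (rule that[OF L'])
    fix n assume "represents L B n"
    from rep'[OF this, of 0 "replicate (length cs) 0"] show "represents L' B' n"
      by (simp add: sum_list_unary_zero_vector)
  next
    fix n assume n: "a < n"
    \<comment> \<open>One multiple of \<open>a + 1\<close> is moved from the quotient to the
      remainder: a remainder at most \<open>a\<close> could not serve as a coefficient, whereas
      \<open>b\<close> lies in the range of \<open>cs\<close>. The quotient stays nonnegative
      because \<open>n > a\<close>.\<close>
    define q where "q = n div (a + 1) - 1"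
    define b where "b = a + 1 + n mod (a + 1)"
    have "1 \<le> n div (a + 1)" using n L(3) pos_imp_zdiv_pos_iff[of "a + 1" n] by simp
    then have q: "0 \<le> q" by (simp add: q_def)
    have "(a + 1) * q + b = (a + 1) * (n div (a + 1)) + n mod (a + 1)"
      unfolding q_def b_def right_diff_distrib by simp
    then have nq: "n = (a + 1) * q + b" by simp
    have "0 \<le> n mod (a + 1)" "n mod (a + 1) < a + 1"
      using L(3) by (intro pos_mod_sign pos_mod_bound; simp)+
    then have "b \<in> set cs" by (auto simp: cs_def b_def)
    then obtain xs where "length xs = length cs" "?Q cs xs = b"
      by (rule sum_list_unary_unit_vector)
    with rep'[OF represents_zero[OF L(1)] q] nq show "represents L' B' n" by fastforce
  qed
qed

section \<open>Truants\<close>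

definition truants :: "int set \<Rightarrow> int set" where
  "truants S = {a \<in> S. \<exists>(L :: (nat \<Rightarrow>\<^sub>0 int) set) B. Z_lattice frag_cmul L B \<and>
    (\<forall>b\<in>S. b < a \<longrightarrow> represents L B b) \<and> \<not> represents L B a}"

text \<open>The enlarged lattice represents every element of \<open>S\<close> except
  \<open>a\<close>. If \<open>S0\<close> omitted \<open>a\<close>, this lattice would be universal
  for \<open>S0\<close> but not for \<open>S\<close>.\<close>

lemma truants_subset_criterion_set:
  assumes "\<forall>a\<in>S. 0 < a" "criterion_set S S0"
  shows "truants S \<subseteq> S0"
proof
  fix a assume "a \<in> truants S"
  then obtain L :: "(nat \<Rightarrow>\<^sub>0 int) set" and B where a: "a \<in> S" and
    L: "Z_lattice frag_cmul L B" "\<forall>b\<in>S. b < a \<longrightarrow> represents L B b" "\<not> represents L B a"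
    unfolding truants_def by blast
  have "0 \<le> a" using a assms(1) by fastforce
  then obtain L' :: "(nat \<Rightarrow>\<^sub>0 int) set" and B' where L':
    "Z_lattice frag_cmul L' B'" "\<not> represents L' B' a"
    "\<And>n. represents L B n \<Longrightarrow> represents L' B' n" "\<And>n. a < n \<Longrightarrow> represents L' B' n"
    using adjoin_all_above[OF L(1,3)] by metis
  show "a \<in> S0"
  proof (rule ccontr)
    assume "a \<notin> S0"
    have "represents L' B' b" if "b \<in> S0" for b
    proof -
      have "b \<in> S" using that assms(2) by (auto simp: criterion_set_def)
      moreover have "b \<noteq> a" using that \<open>a \<notin> S0\<close> by blast
      ultimately show ?thesis using L(2) L'(3,4) by (cases "b < a") auto
    qed
    then have "universal S L' B'"
      using assms(2) L'(1) by (auto simp: criterion_set_def universal_def)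
    with a L'(2) show False by (simp add: universal_def)
  qed
qed

text \<open>By strong induction, once all smaller elements of \<open>S\<close> are represented,
  failure at \<open>a\<close> would make \<open>a\<close> a truant with this very lattice as
  witness.\<close>

lemma criterion_set_truants:
  assumes "\<forall>a\<in>S. 0 < a"
  shows "criterion_set S (truants S)"
  unfolding criterion_set_def
proof (intro conjI allI impI)
  show "truants S \<subseteq> S" by (auto simp: truants_def)
next
  fix L :: "(nat \<Rightarrow>\<^sub>0 int) set" and B
  assume L: "Z_lattice frag_cmul L B" "universal (truants S) L B"
  have "a \<in> S \<Longrightarrow> represents L B a" for a
  proof (induction "nat a" arbitrary: a rule: less_induct)
    case less
    \<comment> \<open>Positivity of \<open>a\<close> turns \<open>b < a\<close> into
      \<open>nat b < nat a\<close>.\<close>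
    have "represents L B b" if "b \<in> S" "b < a" for b
      using less.hyps that assms less.prems by force
    then show ?case
      using L less.prems unfolding truants_def universal_def by blast
  qed
  then show "universal S L B" by (simp add: universal_def)
qed

text \<open>A criterion set contained in all others is minimal, and every minimal one, containing
  it, must equal it.\<close>

theorem theorem2p2:
  fixes S :: "int set"
  assumes "\<forall>a\<in>S. 0 < a"
  shows "\<exists>!S0. minimal_criterion_set S S0"
proof (rule ex1I)
  show "minimal_criterion_set S (truants S)"
    unfolding minimal_criterion_set_def
    using criterion_set_truants[OF assms] truants_subset_criterion_set[OF assms] by blast
next
  fix S0 assume "minimal_criterion_set S S0"
  then show "S0 = truants S"
    unfolding minimal_criterion_set_def
    using criterion_set_truants[OF assms] truants_subset_criterion_set[OF assms] by blast
qed

end
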